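(* Let $n\ge 1$ and let $p,k,q$ be integers with $p\ge n-1$, $k\ge 0$, $q\ge 0$ and $\binom{n}{2}=k\cdot p+q$. Then $K_n$ has a Gallai $(k+1)$-coloring in which $k$ of the color classes have exactly $p$ edges each and the remaining color class has exactly $q$ edges.
   Context: A Gallai $m$-coloring of the complete graph $K_n$ is an assignment of one of the colors $1,\dots,m$ to each edge of $K_n$ (adjacent edges may have the same color, and a color class is allowed to be empty) such that no triangle has its three edges colored with three pairwise different colors. A color class is the set of all edges of a given color. *)

theory Defs
  imports "HOL-Library.Ramsey"
begin

text \<open>
  The complete graph on a vertex set \<open>V\<close> has edge set \<open>nsets V 2\<close>, the set of all two-element
  subsets of \<open>V\<close>; the graph \<open>K\<^sub>n\<close> is the case \<open>V = {1..n}\<close>. Values of a coloring \<open>f\<close> outside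
  \<open>nsets V 2\<close> are irrelevant.
\<close>

definition edge_coloring :: "'v set \<Rightarrow> nat \<Rightarrow> ('v set \<Rightarrow> nat) \<Rightarrow> bool" where
  "edge_coloring V m f \<longleftrightarrow> f \<in> nsets V 2 \<rightarrow> {1..m}"

definition gallai_coloring :: "'v set \<Rightarrow> nat \<Rightarrow> ('v set \<Rightarrow> nat) \<Rightarrow> bool" where
  "gallai_coloring V m f \<longleftrightarrow> edge_coloring V m f \<and>
     (\<forall>x\<in>V. \<forall>y\<in>V. \<forall>z\<in>V. x \<noteq> y \<longrightarrow> y \<noteq> z \<longrightarrow> x \<noteq> z \<longrightarrow>
        \<not> (f {x, y} \<noteq> f {y, z} \<and> f {y, z} \<noteq> f {x, z} \<and> f {x, y} \<noteq> f {x, z}))"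

definition color_class :: "'v set \<Rightarrow> ('v set \<Rightarrow> nat) \<Rightarrow> nat \<Rightarrow> 'v set set" where
  "color_class V f c = {e \<in> nsets V 2. f e = c}"

end

theory Submission
  imports Defs
begin

text \<open>
  Give the edge \<open>{i, j}\<close> with \<open>i < j\<close> a color depending only on \<open>j\<close>. Every such coloring is Gallai,
  and its color classes are unions of stars with \<open>0, 1, \<dots>, n - 1\<close> edges. So it suffices to find
  \<open>k\<close> disjoint subsets of \<open>{1..N}\<close>, \<open>N = n - 1\<close>, each of sum \<open>p\<close>, whenever \<open>p \<ge> N\<close> and
  \<open>k p \<le> N (N + 1) / 2\<close>. This goes by strong induction on \<open>N\<close>. If \<open>N\<close> can be left out, do so. If
  \<open>N < p \<le> 2 N\<close>, form all pairs \<open>{x, p - x}\<close>; when \<open>p\<close> is even, \<open>p / 2\<close> stays unpaired and the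
  remaining problem is stated with sets of sum \<open>p / 2\<close>, one of which is already there. If \<open>p > 2 N\<close>,
  put into each set a pair taken from the largest numbers, all pairs having the same sum.
  Then the smaller problem has sums at least \<open>N - 2 k\<close>, except when \<open>N = 4 k + 1\<close> and \<open>p = 2 N + 1\<close>;
  in that case the pairs are taken from the top \<open>2 k + 1\<close> numbers without the middle one.
\<close>

section \<open>Disjoint sets of numbers with equal sums\<close>

definition packs :: "nat set \<Rightarrow> nat \<Rightarrow> nat \<Rightarrow> bool" where
  "packs A p k \<longleftrightarrow> (\<exists>g :: nat \<Rightarrow> nat. \<forall>c<k. \<Sum>{x \<in> A. g x = c} = p)"

lemma packs_0 [simp]: "packs A p 0"
  by (simp add: packs_def)

lemma packs_single: "packs {p} p 1"
  unfolding packs_def by (rule exI[of _ "\<lambda>_. 0"]) auto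

lemma packs_mono:
  assumes "packs A p k" "A \<subseteq> B"
  shows "packs B p k"
proof -
  obtain g where g: "\<forall>c<k. \<Sum>{x \<in> A. g x = c} = p"
    using assms(1) unfolding packs_def by blast
  have "{x \<in> B. (if x \<in> A then g x else k) = c} = {x \<in> A. g x = c}" if "c < k" for c
    using that assms(2) by auto
  then show ?thesis
    unfolding packs_def using g by (intro exI[of _ "\<lambda>x. if x \<in> A then g x else k"]) simp
qed

lemma packs_le: "packs A p l \<Longrightarrow> k \<le> l \<Longrightarrow> packs A p k"
  unfolding packs_def by (meson less_le_trans)

lemma packs_append:
  assumes "packs A p k" "packs B p l" "A \<inter> B = {}"
  shows "packs (A \<union> B) p (k + l)"
proof -
  obtain g where g: "\<forall>c<k. \<Sum>{x \<in> A. g x = c} = p"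
    using assms(1) unfolding packs_def by blast
  obtain h where h: "\<forall>c<l. \<Sum>{x \<in> B. h x = c} = p"
    using assms(2) unfolding packs_def by blast
  define u where "u = (\<lambda>x. if x \<in> B then k + h x else if g x < k then g x else k + l)"
  have "\<Sum>{x \<in> A \<union> B. u x = c} = p" if c: "c < k + l" for c
  proof (cases "c < k")
    case True
    then have "{x \<in> A \<union> B. u x = c} = {x \<in> A. g x = c}"
      using assms(3) by (auto simp: u_def)
    then show ?thesis using g True by simp
  next
    case False
    then have "{x \<in> A \<union> B. u x = c} = {x \<in> B. h x = c - k}"
      using assms(3) c by (auto simp: u_def)
    then show ?thesis using h False c by simp
  qed
  then show ?thesis unfolding packs_def by blast
qed

lemma packs_add:
  assumes "packs A p k" "packs B q k" "A \<inter> B = {}" "finite A" "finite B"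
  shows "packs (A \<union> B) (p + q) k"
proof -
  obtain g where g: "\<forall>c<k. \<Sum>{x \<in> A. g x = c} = p"
    using assms(1) unfolding packs_def by blast
  obtain h where h: "\<forall>c<k. \<Sum>{x \<in> B. h x = c} = q"
    using assms(2) unfolding packs_def by blast
  define u where "u = (\<lambda>x. if x \<in> B then h x else g x)"
  have "\<Sum>{x \<in> A \<union> B. u x = c} = p + q" if c: "c < k" for c
  proof -
    have "{x \<in> A \<union> B. u x = c} = {x \<in> A. g x = c} \<union> {x \<in> B. h x = c}"
      using assms(3) by (auto simp: u_def)
    moreover have "\<Sum>({x \<in> A. g x = c} \<union> {x \<in> B. h x = c}) = p + q"
      using g h c assms(3-5) by (subst sum.union_disjoint) auto
    ultimately show ?thesis by simp
  qed
  then show ?thesis unfolding packs_def by blast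
qed

text \<open>Merge the sets labelled \<open>2 * c\<close> and \<open>2 * c + 1\<close>.\<close>

lemma packs_double:
  assumes "packs A p (2 * k)" "finite A"
  shows "packs A (2 * p) k"
proof -
  obtain g where g: "\<forall>c<2 * k. \<Sum>{x \<in> A. g x = c} = p"
    using assms(1) unfolding packs_def by blast
  have "\<Sum>{x \<in> A. g x div 2 = c} = 2 * p" if c: "c < k" for c
  proof -
    have "{x \<in> A. g x div 2 = c} = {x \<in> A. g x = 2 * c} \<union> {x \<in> A. g x = 2 * c + 1}"
      by auto
    moreover have "\<Sum>({x \<in> A. g x = 2 * c} \<union> {x \<in> A. g x = 2 * c + 1}) = 2 * p"
      using g c assms(2) by (subst sum.union_disjoint) auto
    ultimately show ?thesis by simp
  qed
  then show ?thesis unfolding packs_def by (intro exI[of _ "\<lambda>x. g x div 2"]) simp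
qed

text \<open>Run up one block and down the other: \<open>a + c\<close> meets
  \<open>b + k - 1 - c\<close>, so the sum is constant.\<close>

lemma packs_pairs:
  assumes "a + k \<le> b" "p + 1 = a + b + k"
  shows "packs ({a..<a + k} \<union> {b..<b + k}) p k"
proof -
  define g where "g = (\<lambda>x. if x < a + k then x - a else b + k - 1 - x)"
  have "\<Sum>{x \<in> {a..<a + k} \<union> {b..<b + k}. g x = c} = p" if c: "c < k" for c
  proof -
    have "{x \<in> {a..<a + k} \<union> {b..<b + k}. g x = c} = {a + c, b + k - 1 - c}"
      using c assms by (auto simp: g_def)
    then show ?thesis using c assms by simp
  qed
  then show ?thesis unfolding packs_def by blast
qed

section \<open>Packing an initial segment\<close>

lemma packs_interval:
  assumes "p \<ge> N" "2 * (k * p) \<le> N * (N + 1)"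
  shows "packs {1..N} p k"
  using assms
proof (induction N arbitrary: p k rule: less_induct)
  case (less N)
  consider "k = 0" | "k > 0" "N = 0" | "N > 0" "2 * (k * p) \<le> (N - 1) * N"
    | "k > 0" "N > 0" "p = N"
    | "N < p" "p \<le> 2 * N" "odd p" | "N < p" "p \<le> 2 * N" "even p"
    | "k > 0" "N > 0" "2 * N < p" "2 * (k * p) > (N - 1) * N"
    using less.prems by linarith
  then show ?case
  proof cases
    case 1
    then show ?thesis by simp
  next
    case 2
    then have "p = 0" using less.prems by simp
    then show ?thesis using 2 by (auto simp: packs_def)
  next
    case 3
    then have "packs {1..N - 1} p k"
      using less.prems by (intro less.IH) auto
    then show ?thesis by (rule packs_mono) auto
  next
    case 4
    obtain l where l: "k = Suc l" using 4 by (cases k) auto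
    obtain M where M: "N = Suc M" using 4 by (cases N) auto
    have "packs {1..M} p l"
      using less.prems 4 l M by (intro less.IH) (auto simp: algebra_simps)
    from packs_append[OF packs_single[of p] this] have "packs ({p} \<union> {1..M}) p k"
      using 4 l M by simp
    then show ?thesis by (rule packs_mono) (use 4 M in auto)
  next
    case 5
    \<comment> \<open>The partner of \<open>N\<close> is \<open>p - N = m + 1\<close>, so the
      \<open>r\<close> pairs use up exactly \<open>{m + 1..N}\<close>.\<close>
    define m where "m = p - N - 1"
    define r where "r = (2 * N + 1 - p) div 2"
    have p: "p = m + N + 1" using 5 by (simp add: m_def)
    have N: "N = m + 2 * r"
      using 5 unfolding r_def m_def by (auto elim!: oddE)
    have pr: "packs ({m + 1..<m + 1 + r} \<union> {m + 1 + r..<m + 1 + r + r}) p r"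
      by (rule packs_pairs) (use p N in simp_all)
    have "packs {1..m} p (k - r)"
    proof (rule less.IH)
      show "m < N" using 5 by (simp add: m_def)
      show "m \<le> p" by (simp add: m_def)
      \<comment> \<open>The pairs remove \<open>r * p\<close> from the total sum and from the demand
        alike; for \<open>k \<le> r\<close> the truncated difference is 0.\<close>
      show "2 * ((k - r) * p) \<le> m * (m + 1)"
      proof (cases "k \<le> r")
        case False
        then obtain s where "k = r + s" using le_Suc_ex nat_le_linear by blast
        then show ?thesis using less.prems(2) p N by (simp add: algebra_simps)
      qed simp
    qed
    then have "packs ({m + 1..<m + 1 + r} \<union> {m + 1 + r..<m + 1 + r + r} \<union> {1..m}) p (r + (k - r))"
      by (rule packs_append[OF pr]) auto
    then have "packs {1..N} p (r + (k - r))"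
      by (rule packs_mono) (use N in auto)
    then show ?thesis by (rule packs_le) simp
  next
    case 6
    define h where "h = p div 2"
    define m where "m = p - N - 1"
    \<comment> \<open>Each of the \<open>r\<close> numbers above \<open>h\<close> is paired with one
      below \<open>h\<close>.\<close>
    define r where "r = N - h"
    have p: "p = m + N + 1" "p = 2 * h" using 6 by (auto simp: m_def h_def)
    have hN: "h \<le> N" using 6 by (simp add: h_def)
    then have N: "N = m + 2 * r + 1" "h = m + 1 + r" using p by (auto simp: r_def)
    have pr: "packs ({m + 1..<m + 1 + r} \<union> {m + 2 + r..<m + 2 + r + r}) p r"
      by (rule packs_pairs) (use p N in simp_all)
    have "packs ({h} \<union> {1..m}) p (k - r)"
    proof (cases "k \<le> r")
      case False
      then have "k = r + Suc (k - r - 1)" by simp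
      then obtain s where s: "k = r + Suc s" ..
      \<comment> \<open>Together with \<open>{h}\<close> these make \<open>2 * Suc s\<close> sets of
        sum \<open>h\<close>, which merge two by two into \<open>k - r\<close> sets of sum
        \<open>p\<close>.\<close>
      have "packs {1..m} h (2 * s + 1)"
        using less.prems(2) p N s by (intro less.IH) (auto simp: algebra_simps)
      from packs_append[OF packs_single[of h] this]
      have "packs ({h} \<union> {1..m}) h (2 * Suc s)" using N by (simp del: Un_insert_left)
      from packs_double[OF this] show ?thesis using p s by simp
    qed simp
    then have "packs ({m + 1..<m + 1 + r} \<union> {m + 2 + r..<m + 2 + r + r} \<union> ({h} \<union> {1..m})) p
        (r + (k - r))"
      by (rule packs_append[OF pr]) (use N in auto)
    then have "packs {1..N} p (r + (k - r))"
      by (rule packs_mono) (use N in auto)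
    then show ?thesis by (rule packs_le) simp
  next
    case 7
    have "2 * (k * (2 * N + 1)) \<le> 2 * (k * p)"
      using 7(3) by (intro mult_le_mono2) simp
    also note less.prems(2)
    finally have kN: "2 * (k * (2 * N + 1)) \<le> N * (N + 1)" .
    \<comment> \<open>Since \<open>p\<close> exceeds \<open>2 * N\<close>, the bound on the total
      sum leaves room for few sets only.\<close>
    have "4 * k \<le> N"
    proof (rule ccontr)
      assume "\<not> 4 * k \<le> N"
      then have "(N + 1) * (2 * N + 1) \<le> 4 * k * (2 * N + 1)" by (intro mult_le_mono1) simp
      then show False using kN by (simp add: algebra_simps)
    qed
    then obtain j where j: "N = 4 * k + j" using le_Suc_ex by blast
    show ?thesis
    \<comment> \<open>The top \<open>2 * k\<close> numbers form pairs of sum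
      \<open>2 * N + 1 - 2 * k\<close>. The threshold says exactly that the remaining sum
      \<open>q\<close> is at least \<open>N - 2 * k\<close>, as induction requires.\<close>
    proof (cases "p \<ge> 2 * N + j + 1")
      case True
      define q where "q = p - (2 * N + 1 - 2 * k)"
      define m where "m = N - 2 * k"
      have p: "p = q + 2 * m + 2 * k + 1" "N = m + 2 * k"
        using 7 True j by (auto simp: q_def m_def)
      have pr: "packs ({m + 1..<m + 1 + k} \<union> {m + 1 + k..<m + 1 + k + k}) (2 * m + 2 * k + 1) k"
        by (rule packs_pairs) auto
      have "packs {1..m} q k"
      proof (rule less.IH)
        show "m < N" using p 7(1) by simp
        show "m \<le> q" using p True j by linarith
        show "2 * (k * q) \<le> m * (m + 1)"
          using less.prems(2) unfolding p by (simp add: algebra_simps)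
      qed
      then have "packs ({m + 1..<m + 1 + k} \<union> {m + 1 + k..<m + 1 + k + k} \<union> {1..m})
          (2 * m + 2 * k + 1 + q) k"
        by (intro packs_add[OF pr]) auto
      moreover have "2 * m + 2 * k + 1 + q = p" using p by simp
      ultimately have "packs ({m + 1..<m + 1 + k} \<union> {m + 1 + k..<m + 1 + k + k} \<union> {1..m}) p k"
        by simp
      then show ?thesis by (rule packs_mono) (use p in auto)
    next
      case False
      \<comment> \<open>Here \<open>2 * N < p \<le> 2 * N + j\<close>, so \<open>j\<close> is
        positive; for \<open>j \<ge> 2\<close> the number \<open>N\<close> could be left out,
        contrary to the case.\<close>
      have "j = 1"
      proof (rule ccontr)
        assume "j \<noteq> 1"
        then have "j = j - 2 + 2" using False 7 by arith
        then obtain i where i: "j = i + 2" ..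
        have "2 * (k * p) \<le> 2 * (k * (2 * N + j))"
          using False by (intro mult_le_mono2) simp
        then show False using 7(4) unfolding j i by (simp add: algebra_simps)
      qed
      then have p: "p = 2 * N + 1" using False 7 by simp
      \<comment> \<open>The top \<open>2 * k\<close> numbers would leave the sum
        \<open>2 * k\<close> to be made from \<open>{1..2 * k + 1}\<close>, which is too small.
        Skipping \<open>3 * k + 1\<close> leaves the sum \<open>2 * k + 1\<close> and
        \<open>{1..2 * k}\<close>.\<close>
      have pr: "packs ({2 * k + 1..<2 * k + 1 + k} \<union> {3 * k + 2..<3 * k + 2 + k}) (6 * k + 2) k"
        by (rule packs_pairs) auto
      have "packs {1..2 * k} (2 * k + 1) k"
        using j 7 by (intro less.IH) (auto simp: algebra_simps)
      then have "packs ({2 * k + 1..<2 * k + 1 + k} \<union> {3 * k + 2..<3 * k + 2 + k} \<union> {1..2 * k})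
          (6 * k + 2 + (2 * k + 1)) k"
        by (intro packs_add[OF pr]) auto
      moreover have "6 * k + 2 + (2 * k + 1) = p" using p j \<open>j = 1\<close> by simp
      ultimately have "packs ({2 * k + 1..<2 * k + 1 + k} \<union> {3 * k + 2..<3 * k + 2 + k} \<union> {1..2 * k}) p k"
        by simp
      then show ?thesis by (rule packs_mono) (use j \<open>j = 1\<close> in auto)
    qed
  qed
qed

section \<open>Colorings determined by the larger endpoint\<close>

text \<open>The edges with larger endpoint \<open>Suc x\<close> form a star of \<open>x\<close>
  edges, and these stars are disjoint.\<close>

lemma card_star_class:
  fixes n :: nat
  assumes "\<And>e. e \<in> nsets {1..n} 2 \<Longrightarrow> f e = F (Max e)"
  shows "card (color_class {1..n} f d) = (\<Sum>x | x \<in> {1..n - 1} \<and> F (Suc x) = d. x)"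
proof -
  let ?X = "{x \<in> {1..n - 1}. F (Suc x) = d}"
  let ?E = "\<lambda>x. (\<lambda>y. {y, Suc x}) ` {1..x}"
  have "color_class {1..n} f d = (\<Union>x\<in>?X. ?E x)"
  proof (intro equalityI subsetI)
    fix e assume "e \<in> color_class {1..n} f d"
    then have e: "e \<in> nsets {1..n} 2" "f e = d" by (auto simp: color_class_def)
    then obtain x y where "e = {x, y}" "x \<noteq> y" "x \<in> {1..n}" "y \<in> {1..n}"
      unfolding nsets_2_eq by blast
    then obtain a b where ab: "e = {a, b}" "a < b" "a \<in> {1..n}" "b \<in> {1..n}"
      by (metis insert_commute linorder_neqE_nat)
    moreover have "F b = d" using assms[OF e(1)] e(2) ab by (simp add: max_def)
    ultimately show "e \<in> (\<Union>x\<in>?X. ?E x)"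
      by (intro UN_I[of "b - 1"] image_eqI[of _ _ a]) auto
  next
    fix e assume "e \<in> (\<Union>x\<in>?X. ?E x)"
    then obtain x y where xy: "x \<in> ?X" "y \<in> {1..x}" "e = {y, Suc x}" by blast
    then have "e \<in> nsets {1..n} 2" by (auto simp: nsets_def)
    with assms[OF this] xy show "e \<in> color_class {1..n} f d"
      by (auto simp: color_class_def max_def)
  qed
  then have "card (color_class {1..n} f d) = card (\<Union>x\<in>?X. ?E x)"
    by simp
  also have "\<dots> = (\<Sum>x\<in>?X. card (?E x))"
    by (rule card_UN_disjoint) (auto simp: doubleton_eq_iff)
  also have "\<dots> = (\<Sum>x\<in>?X. x)"
  proof (rule sum.cong)
    fix x
    have "inj_on (\<lambda>y. {y, Suc x}) {1..x}"
      by (rule inj_onI) (auto simp: doubleton_eq_iff)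
    then show "card (?E x) = x" by (simp add: card_image)
  qed simp
  finally show ?thesis by simp
qed

lemma sum_card_color_class:
  assumes "edge_coloring V m f" "finite V"
  shows "(\<Sum>c\<in>{1..m}. card (color_class V f c)) = card V choose 2"
proof -
  have "(\<Sum>c\<in>{1..m}. card (color_class V f c)) = card (\<Union>c\<in>{1..m}. color_class V f c)"
    using assms(2) by (intro card_UN_disjoint[symmetric]) (auto simp: color_class_def finite_imp_finite_nsets)
  also have "(\<Union>c\<in>{1..m}. color_class V f c) = nsets V 2"
    using assms(1) by (auto simp: color_class_def edge_coloring_def)
  finally show ?thesis by simp
qed

theorem theorem4:
  fixes n :: nat and p k q :: int
  assumes "n \<ge> 1"
    and "p \<ge> int n - 1"
    and "k \<ge> 0"
    and "q \<ge> 0"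
    and "int (n choose 2) = k * p + q"
  shows "\<exists>f. gallai_coloring {1..n} (nat k + 1) f \<and>
           (\<exists>c\<in>{1..nat k + 1}.
              int (card (color_class {1..n} f c)) = q \<and>
              (\<forall>d\<in>{1..nat k + 1} - {c}. int (card (color_class {1..n} f d)) = p))"
proof -
  define K where "K = nat k"
  define P where "P = nat p"
  have kp: "k = int K" "p = int P" using assms by (auto simp: K_def P_def)
  have tot: "int (n choose 2) = int (K * P) + q" using assms(5) kp by simp
  then have "K * P \<le> n choose 2" using assms(4) by linarith
  moreover have "2 * (n choose 2) = n * (n - 1)" by (cases n) (simp_all add: choose_two)
  ultimately have "2 * (K * P) \<le> (n - 1) * (n - 1 + 1)" using assms(1) by (simp add: mult.commute)
  moreover have "P \<ge> n - 1" using assms(2) kp by linarith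
  ultimately have "packs {1..n - 1} P K" by (rule packs_interval[rotated])
  then obtain g where g: "\<And>c. c < K \<Longrightarrow> \<Sum>{x \<in> {1..n - 1}. g x = c} = P"
    unfolding packs_def by blast
  define F where "F = (\<lambda>v. Suc (min (g (v - 1)) K))"
  define f where "f = (\<lambda>e. F (Max e))"
  have ec: "edge_coloring {1..n} (K + 1) f"
    by (auto simp: edge_coloring_def f_def F_def)
  \<comment> \<open>In any triangle the two edges at the largest vertex have the same color.\<close>
  have "gallai_coloring {1..n} (K + 1) f"
    unfolding gallai_coloring_def using ec by (auto simp: f_def max_def)
  moreover have cP: "card (color_class {1..n} f d) = P" if d: "d \<in> {1..K + 1} - {K + 1}" for d
  proof -
    have "card (color_class {1..n} f d) = \<Sum>{x \<in> {1..n - 1}. F (Suc x) = d}"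
      by (rule card_star_class) (simp add: f_def)
    also have "{x \<in> {1..n - 1}. F (Suc x) = d} = {x \<in> {1..n - 1}. g x = d - 1}"
      using d by (auto simp: F_def)
    also have "\<Sum>\<dots> = P"
      using d by (intro g) auto
    finally show ?thesis .
  qed
  \<comment> \<open>The last class has what the \<open>K\<close> classes of size \<open>P\<close>
    leave of all edges.\<close>
  moreover have "int (card (color_class {1..n} f (K + 1))) = q"
  proof -
    have "n choose 2 = (\<Sum>c\<in>{1..K + 1}. card (color_class {1..n} f c))"
      using sum_card_color_class[OF ec] by simp
    also have "\<dots> = (\<Sum>c\<in>{1..K}. card (color_class {1..n} f c)) + card (color_class {1..n} f (K + 1))"
      by simp
    also have "(\<Sum>c\<in>{1..K}. card (color_class {1..n} f c)) = (\<Sum>c\<in>{1..K}. P)"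
      by (intro sum.cong refl cP) auto
    finally show ?thesis using tot by simp
  qed
  ultimately show ?thesis
    unfolding K_def[symmetric] kp(2)
    by (intro exI[of _ f] conjI bexI[of _ "K + 1"]) auto
qed

end
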